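(* Let $\mathscr{A} \in \mathbb{E}$ be such that, for some real numbers $\alpha_1,\dots,\alpha_{10}$ and real $3\times 3$ matrices $\mathbf{U}_1,\dots,\mathbf{U}_{10}$, $$\mathscr{A}\mathbf{y}^2 = \sum_{s=1}^{10} \alpha_s (\mathbf{U}_s\mathbf{y})(\mathbf{U}_s\mathbf{y})^\top \quad \text{for all } \mathbf{y} \in \mathbb{R}^3,$$ where (i) $\alpha_1,\dots,\alpha_9 > 0$ and $\alpha_{10} < 0$; (ii) $\mathbf{U}_s = \mathbf{v}_s\mathbf{w}_s^\top$ with $\mathbf{v}_s,\mathbf{w}_s \in \mathbb{R}^3$ for $s = 1,2,\dots,9$, and $\mathbf{v}_s = \mathbf{v}_{s+3} = \mathbf{v}_{s+6}$ for $s = 1,2,3$; (iii) the matrices $\mathbf{V} = [\mathbf{v}_1,\mathbf{v}_2,\mathbf{v}_3]$, $\mathbf{W} = [\mathbf{w}_1,\mathbf{w}_2,\mathbf{w}_3]$, $\widetilde{\mathbf{W}} = [\mathbf{w}_4,\mathbf{w}_5,\mathbf{w}_6]$ and $\widehat{\mathbf{W}} = [\mathbf{w}_7,\mathbf{w}_8,\mathbf{w}_9]$ are nonsingular; (iv) $\mathbf{w}_s,\mathbf{w}_{s+3},\mathbf{w}_{s+6}$ are linearly independent for $s = 1,2,3$. Then $\mathscr{A}$ is M-PSD if and only if there exist real numbers $\sigma_1,\dots,\sigma_9$ such that (i) $\mathbf{U}_{10} = \mathbf{V}\boldsymbol{\Sigma}_{10}\mathbf{W}^\top + \mathbf{V}\widetilde{\boldsymbol{\Sigma}}_{10}\widetilde{\mathbf{W}}^\top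 + \mathbf{V}\widehat{\boldsymbol{\Sigma}}_{10}\widehat{\mathbf{W}}^\top$ with $\boldsymbol{\Sigma}_{10} = \mathrm{diag}(\sigma_1,\sigma_2,\sigma_3)$, $\widetilde{\boldsymbol{\Sigma}}_{10} = \mathrm{diag}(\sigma_4,\sigma_5,\sigma_6)$, $\widehat{\boldsymbol{\Sigma}}_{10} = \mathrm{diag}(\sigma_7,\sigma_8,\sigma_9)$; and (ii) $\displaystyle \max\big\{\eta(\mathbf{y}) : \mathbf{y} \in \mathbb{R}^3,\ \mathbf{y}^\top\mathbf{y} = 1\big\} \leq \frac{1}{-\alpha_{10}}$, where $$\eta(\mathbf{y}) := \sum_{s=1}^3 \frac{(\sigma_s\mathbf{w}_s^\top\mathbf{y} + \sigma_{s+3}\mathbf{w}_{s+3}^\top\mathbf{y} + \sigma_{s+6}\mathbf{w}_{s+6}^\top\mathbf{y})^2}{\alpha_s(\mathbf{w}_s^\top\mathbf{y})^2 + \alpha_{s+3}(\mathbf{w}_{s+3}^\top\mathbf{y})^2 + \alpha_{s+6}(\mathbf{w}_{s+6}^\top\mathbf{y})^2}.$$ Furthermore, $\mathscr{A}$ is M-PD when (i) holds and the inequality in (ii) is strict.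
   Context: $\mathbb{E}$ denotes the set of all real fourth-order three-dimensional tensors $\mathscr{A} = (a_{ijkl}) \in \mathbb{R}^{3\times 3\times 3\times 3}$ such that $a_{ijkl} = a_{jikl} = a_{ijlk}$ for all $i,j,k,l \in \{1,2,3\}$. For $\mathbf{y} \in \mathbb{R}^3$, $\mathscr{A}\mathbf{y}^2$ is the symmetric $3\times 3$ matrix with entries $(\mathscr{A}\mathbf{y}^2)_{ij} := \sum_{k,l=1}^3 a_{ijkl}y_ky_l$. Set $\mathscr{A}\mathbf{x}^2\mathbf{y}^2 := \sum_{i,j,k,l=1}^3 a_{ijkl}x_ix_jy_ky_l$. The tensor $\mathscr{A}$ is M-positive definite (M-PD) if $\mathscr{A}\mathbf{x}^2\mathbf{y}^2 > 0$ for all nonzero $\mathbf{x},\mathbf{y} \in \mathbb{R}^3$, and M-positive semidefinite (M-PSD) if $\mathscr{A}\mathbf{x}^2\mathbf{y}^2 \geq 0$ for all $\mathbf{x},\mathbf{y} \in \mathbb{R}^3$. *)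

theory Defs
  imports "HOL-Analysis.Analysis"
begin

type_synonym tensor4 = "real^3^3^3^3"

definition tensor_space :: "tensor4 set" where
  "tensor_space = {A. \<forall>i j k l. A $ i $ j $ k $ l = A $ j $ i $ k $ l \<and>
                                 A $ i $ j $ k $ l = A $ i $ j $ l $ k}"

definition tensor_apply2 :: "tensor4 \<Rightarrow> real^3 \<Rightarrow> real^3^3" where
  "tensor_apply2 A y = (\<chi> i j. \<Sum>k\<in>UNIV. \<Sum>l\<in>UNIV. A $ i $ j $ k $ l * y $ k * y $ l)"

definition biquadratic :: "tensor4 \<Rightarrow> real^3 \<Rightarrow> real^3 \<Rightarrow> real" where
  "biquadratic A x y =
     (\<Sum>i\<in>UNIV. \<Sum>j\<in>UNIV. \<Sum>k\<in>UNIV. \<Sum>l\<in>UNIV. A $ i $ j $ k $ l * x $ i * x $ j * y $ k * y $ l)"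

definition M_PD :: "tensor4 \<Rightarrow> bool" where
  "M_PD A \<longleftrightarrow> (\<forall>x y. x \<noteq> 0 \<longrightarrow> y \<noteq> 0 \<longrightarrow> biquadratic A x y > 0)"

definition M_PSD :: "tensor4 \<Rightarrow> bool" where
  "M_PSD A \<longleftrightarrow> (\<forall>x y. biquadratic A x y \<ge> 0)"

definition outer_product :: "real^3 \<Rightarrow> real^3 \<Rightarrow> real^3^3" where
  "outer_product a b = (\<chi> i j. a $ i * b $ j)"

text \<open>The matrix \<open>[a, b, c]\<close> with columns \<open>a\<close>, \<open>b\<close>, \<open>c\<close>; the term
  \<open>vector [a, b, c]\<close> alone would have them as rows.\<close>

definition cols3 :: "real^3 \<Rightarrow> real^3 \<Rightarrow> real^3 \<Rightarrow> real^3^3" where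
  "cols3 a b c = transpose (vector [a, b, c])"

definition diag3 :: "real \<Rightarrow> real \<Rightarrow> real \<Rightarrow> real^3^3" where
  "diag3 a b c = (\<chi> i j. if i = j then (vector [a, b, c] :: real^3) $ i else 0)"

text \<open>Linear independence of three vectors as a family: \<^const>\<open>independent\<close> is a property
  of sets, so distinctness has to be required separately.\<close>

definition lin_indep3 :: "real^3 \<Rightarrow> real^3 \<Rightarrow> real^3 \<Rightarrow> bool" where
  "lin_indep3 a b c \<longleftrightarrow> distinct [a, b, c] \<and> independent {a, b, c}"

definition is_maximum :: "real set \<Rightarrow> real \<Rightarrow> bool" where
  "is_maximum S m \<longleftrightarrow> m \<in> S \<and> (\<forall>x\<in>S. x \<le> m)"

text \<open>For positive \<open>\<alpha> 1, \<dots>, \<alpha> 9\<close> and linearly independent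
  \<open>w s, w (s + 3), w (s + 6)\<close> the denominators vanish only at \<open>y = 0\<close>.\<close>

definition eta :: "(nat \<Rightarrow> real) \<Rightarrow> (nat \<Rightarrow> real^3) \<Rightarrow> (nat \<Rightarrow> real) \<Rightarrow> real^3 \<Rightarrow> real" where
  "eta \<alpha> w \<sigma> y =
     (\<Sum>s = 1..3.
        (\<sigma> s * (w s \<bullet> y) + \<sigma> (s + 3) * (w (s + 3) \<bullet> y) + \<sigma> (s + 6) * (w (s + 6) \<bullet> y))\<^sup>2 /
        (\<alpha> s * (w s \<bullet> y)\<^sup>2 + \<alpha> (s + 3) * (w (s + 3) \<bullet> y)\<^sup>2 + \<alpha> (s + 6) * (w (s + 6) \<bullet> y)\<^sup>2))"

definition U10_decomposition ::
  "real^3^3 \<Rightarrow> (nat \<Rightarrow> real^3) \<Rightarrow> (nat \<Rightarrow> real^3) \<Rightarrow> (nat \<Rightarrow> real) \<Rightarrow> bool" where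
  "U10_decomposition U10 v w \<sigma> \<longleftrightarrow>
     (let V = cols3 (v 1) (v 2) (v 3) in
      U10 = V ** diag3 (\<sigma> 1) (\<sigma> 2) (\<sigma> 3) ** transpose (cols3 (w 1) (w 2) (w 3))
          + V ** diag3 (\<sigma> 4) (\<sigma> 5) (\<sigma> 6) ** transpose (cols3 (w 4) (w 5) (w 6))
          + V ** diag3 (\<sigma> 7) (\<sigma> 8) (\<sigma> 9) ** transpose (cols3 (w 7) (w 8) (w 9)))"

end

theory Submission
  imports Defs
begin

text \<open>Each triple \<open>w s, w (s + 3), w (s + 6)\<close> is a basis of $\mathbb{R}^3$, so expanding the rows of
  \<open>V\<^sup>-\<^sup>1 U\<^sub>1\<^sub>0\<close> in these bases shows that the decomposition of \<open>U\<^sub>1\<^sub>0\<close> always exists. In the coordinates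
  \<open>t s = x \<bullet> v s\<close>, which range over all of $\mathbb{R}^3$, the form becomes
  \<open>(\<Sum>s. (t s)\<^sup>2 * D s) + \<alpha>\<^sub>1\<^sub>0 * (\<Sum>s. t s * N s)\<^sup>2\<close> where \<open>N s\<close> and \<open>D s\<close> are such that
  \<open>\<eta> = (\<Sum>s. (N s)\<^sup>2 / D s)\<close>. The weighted Cauchy--Schwarz inequality bounds it from below by
  \<open>(\<Sum>s. (t s)\<^sup>2 * D s) * (1 + \<alpha>\<^sub>1\<^sub>0 * \<eta>)\<close>, and its equality case \<open>t s = N s / D s\<close> gives the converse.\<close>

text \<open>Given the decomposition, this is the coefficient of \<open>v s\<close> in
  \<open>U 10 *v y\<close>.\<close>

definition eta_num :: "(nat \<Rightarrow> real) \<Rightarrow> (nat \<Rightarrow> real^3) \<Rightarrow> real^3 \<Rightarrow> nat \<Rightarrow> real" where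
  "eta_num \<sigma> w y s =
     \<sigma> s * (w s \<bullet> y) + \<sigma> (s + 3) * (w (s + 3) \<bullet> y) + \<sigma> (s + 6) * (w (s + 6) \<bullet> y)"

text \<open>The coefficient that \<open>(v s \<bullet> x)\<^sup>2\<close> receives from the nine
  positively weighted terms of the form.\<close>

definition eta_den :: "(nat \<Rightarrow> real) \<Rightarrow> (nat \<Rightarrow> real^3) \<Rightarrow> real^3 \<Rightarrow> nat \<Rightarrow> real" where
  "eta_den \<alpha> w y s =
     \<alpha> s * (w s \<bullet> y)\<^sup>2 + \<alpha> (s + 3) * (w (s + 3) \<bullet> y)\<^sup>2 + \<alpha> (s + 6) * (w (s + 6) \<bullet> y)\<^sup>2"

lemma eta_eq_sum: "eta \<alpha> w \<sigma> y = (\<Sum>s = 1..3. (eta_num \<sigma> w y s)\<^sup>2 / eta_den \<alpha> w y s)"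
  by (simp add: eta_def eta_num_def eta_den_def)

section \<open>Finite sums and a weighted Cauchy-Schwarz inequality\<close>

lemma sum_1_3: "(\<Sum>s = 1..3::nat. f s) = f 1 + f 2 + f 3"
  for f :: "nat \<Rightarrow> 'a::comm_monoid_add"
  by (simp add: numeral_3_eq_3 numeral_2_eq_2)

text \<open>Indices are grouped modulo 3 because \<open>v s\<close>, \<open>v (s + 3)\<close> and
  \<open>v (s + 6)\<close> coincide; index 10, with the negative weight, stays apart.\<close>

lemma sum_1_10:
  "(\<Sum>s = 1..10::nat. f s) = (\<Sum>s = 1..3. f s + f (s + 3) + f (s + 6)) + f 10"
  for f :: "nat \<Rightarrow> 'a::comm_monoid_add"
proof -
  have "{1..10::nat} = {1,2,3,4,5,6,7,8,9,10}"
    by (rule set_eqI) (simp only: atLeastAtMost_iff insert_iff empty_iff, presburger)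
  then show ?thesis
    unfolding sum_1_3 by (simp add: ac_simps)
qed

text \<open>The plain inequality applied to \<open>t i * sqrt (D i)\<close> and
  \<open>N i / sqrt (D i)\<close>.\<close>

lemma weighted_Cauchy_Schwarz:
  fixes t N D :: "'i \<Rightarrow> real"
  assumes "\<And>i. i \<in> I \<Longrightarrow> D i > 0"
  shows "(\<Sum>i\<in>I. t i * N i)\<^sup>2 \<le> (\<Sum>i\<in>I. (t i)\<^sup>2 * D i) * (\<Sum>i\<in>I. (N i)\<^sup>2 / D i)"
proof -
  have "(\<Sum>i\<in>I. t i * N i) = (\<Sum>i\<in>I. (t i * sqrt (D i)) * (N i / sqrt (D i)))"
    using assms by (intro sum.cong refl) (force simp: field_simps)
  moreover have "(\<Sum>i\<in>I. (t i)\<^sup>2 * D i) = (\<Sum>i\<in>I. (t i * sqrt (D i))\<^sup>2)"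
    using assms by (intro sum.cong refl) (simp add: power_mult_distrib less_imp_le)
  moreover have "(\<Sum>i\<in>I. (N i)\<^sup>2 / D i) = (\<Sum>i\<in>I. (N i / sqrt (D i))\<^sup>2)"
    using assms by (intro sum.cong refl) (simp add: power_divide less_imp_le)
  ultimately show ?thesis
    by (simp only: Cauchy_Schwarz_ineq_sum)
qed

section \<open>The form and the decomposition expressed through matrix-vector products\<close>

lemma biquadratic_eq_inner: "biquadratic A x y = x \<bullet> (tensor_apply2 A y *v x)"
  by (simp add: biquadratic_def tensor_apply2_def inner_vec_def matrix_vector_mult_def
      sum_distrib_left sum_distrib_right mult_ac)

lemma outer_product_mult_vec: "outer_product a b *v y = (b \<bullet> y) *\<^sub>R a"
  by (simp add: outer_product_def vec_eq_iff matrix_vector_mult_def inner_vec_def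
      sum_distrib_left sum_distrib_right mult_ac)

text \<open>Each rank-one matrix \<open>outer_product u u\<close> contributes
  \<open>(x \<bullet> u)\<^sup>2\<close> to the form.\<close>

lemma biquadratic_decomp:
  assumes "tensor_apply2 A y = (\<Sum>s\<in>S. \<alpha> s *\<^sub>R outer_product (U s *v y) (U s *v y))"
  shows "biquadratic A x y = (\<Sum>s\<in>S. \<alpha> s * (x \<bullet> (U s *v y))\<^sup>2)"
proof -
  have "(\<Sum>s\<in>S. M s) *v x = (\<Sum>s\<in>S. M s *v x)" for M :: "'a \<Rightarrow> real^3^3"
    by (induction S rule: infinite_finite_induct) (simp_all add: matrix_vector_mult_add_rdistrib)
  then show ?thesis
    unfolding biquadratic_eq_inner assms
    by (simp add: inner_sum_right outer_product_mult_vec scaleR_matrix_vector_assoc[symmetric]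
        power2_eq_square inner_commute mult_ac)
qed

lemma cols3_mult_vec: "cols3 a b c *v t = t $ 1 *\<^sub>R a + t $ 2 *\<^sub>R b + t $ 3 *\<^sub>R c"
  by (simp add: cols3_def vec_eq_iff matrix_vector_mult_def transpose_def forall_3 sum_3 mult_ac)

lemma transpose_cols3_mult_vec: "transpose (cols3 a b c) *v y = vector [a \<bullet> y, b \<bullet> y, c \<bullet> y]"
  by (simp add: cols3_def vec_eq_iff matrix_vector_mult_def transpose_def forall_3 sum_3 inner_vec_def)

lemma diag3_mult_vec: "diag3 a b c *v t = vector [a * t $ 1, b * t $ 2, c * t $ 3]"
  by (simp add: diag3_def vec_eq_iff matrix_vector_mult_def forall_3 sum_3)

text \<open>Applied to \<open>y\<close>, the transposed blocks yield the products
  \<open>w s \<bullet> y\<close>, the diagonals weight them by \<open>\<sigma>\<close>, and the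
  common left factor recombines the columns \<open>v s\<close>.\<close>

lemma U10_decomposition_iff:
  "U10_decomposition M v w \<sigma> \<longleftrightarrow> (\<forall>y. M *v y = (\<Sum>s = 1..3. eta_num \<sigma> w y s *\<^sub>R v s))"
  unfolding U10_decomposition_def Let_def matrix_eq sum_1_3
  by (simp add: matrix_vector_mult_add_rdistrib matrix_vector_mul_assoc[symmetric]
      transpose_cols3_mult_vec diag3_mult_vec cols3_mult_vec eta_num_def algebra_simps
      del: transpose_matrix_vector)

section \<open>Existence of the decomposition\<close>

lemma lin_indep3_span:
  assumes "lin_indep3 a b c"
  shows "span {a, b, c} = UNIV"
proof -
  have "card {a, b, c} = 3" "independent {a, b, c}"
    using assms by (auto simp: lin_indep3_def)
  then have "UNIV \<subseteq> span {a, b, c}"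
    by (intro card_ge_dim_independent) (auto simp: dim_UNIV)
  then show ?thesis
    by auto
qed

lemma lin_indep3_expand:
  assumes "lin_indep3 a b c"
  obtains p q r where "z = p *\<^sub>R a + q *\<^sub>R b + r *\<^sub>R c"
proof -
  have "z \<in> span {a, b, c}"
    using lin_indep3_span[OF assms] by simp
  then obtain p q r where "z - p *\<^sub>R a - q *\<^sub>R b = r *\<^sub>R c"
    by (auto simp: span_insert span_singleton)
  then have "z = p *\<^sub>R a + q *\<^sub>R b + r *\<^sub>R c"
    by (simp add: algebra_simps)
  then show thesis
    by (rule that)
qed

lemma ex_U10_decomposition:
  assumes V: "invertible (cols3 (v 1) (v 2) (v 3))"
    and indep: "\<forall>s\<in>{1..3}. lin_indep3 (w s) (w (s + 3)) (w (s + 6))"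
  shows "\<exists>\<sigma>. U10_decomposition M v w \<sigma>"
proof -
  define V where "V = cols3 (v 1) (v 2) (v 3)"
  obtain V' where V': "V ** V' = mat 1"
    using V unfolding invertible_def V_def by auto
  \<comment> \<open>Row \<open>s\<close> of \<open>R\<close> represents the functional taking
    \<open>y\<close> to the \<open>v s\<close> coordinate of \<open>M *v y\<close>, so its expansion
    in the \<open>s\<close>-th triple supplies the three coefficients for that
    \<open>s\<close>.\<close>
  define R where "R = V' ** M"
  have M: "M *v y = V *v (R *v y)" for y
    by (simp add: R_def matrix_vector_mul_assoc matrix_mul_assoc V')
  have ind: "lin_indep3 (w 1) (w 4) (w 7)" "lin_indep3 (w 2) (w 5) (w 8)"
    "lin_indep3 (w 3) (w 6) (w 9)"
    using indep[rule_format, of 1] indep[rule_format, of 2] indep[rule_format, of 3] by auto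
  obtain a1 a4 a7 where 1: "R $ 1 = a1 *\<^sub>R w 1 + a4 *\<^sub>R w 4 + a7 *\<^sub>R w 7"
    by (rule lin_indep3_expand[OF ind(1)])
  obtain a2 a5 a8 where 2: "R $ 2 = a2 *\<^sub>R w 2 + a5 *\<^sub>R w 5 + a8 *\<^sub>R w 8"
    by (rule lin_indep3_expand[OF ind(2)])
  obtain a3 a6 a9 where 3: "R $ 3 = a3 *\<^sub>R w 3 + a6 *\<^sub>R w 6 + a9 *\<^sub>R w 9"
    by (rule lin_indep3_expand[OF ind(3)])
  \<comment> \<open>List positions start at 0, hence \<open>s - 1\<close>; the decomposition reads
    \<open>\<sigma>\<close> only at 1 to 9.\<close>
  define \<sigma> where "\<sigma> s = [a1, a2, a3, a4, a5, a6, a7, a8, a9] ! (s - 1)" for s :: nat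
  have "R *v y = vector [eta_num \<sigma> w y 1, eta_num \<sigma> w y 2, eta_num \<sigma> w y 3]" for y
    by (simp add: vec_eq_iff forall_3 matrix_vector_mul_component 1 2 3 eta_num_def \<sigma>_def
        inner_add_left)
  then have "U10_decomposition M v w \<sigma>"
    unfolding U10_decomposition_iff M V_def sum_1_3 by (simp add: cols3_mult_vec)
  then show ?thesis
    by blast
qed

section \<open>Positive denominators and the maximum of \<open>eta\<close>\<close>

lemma eta_den_pos:
  assumes pos: "\<forall>s\<in>{1..9}. \<alpha> s > 0"
    and indep: "\<forall>s\<in>{1..3}. lin_indep3 (w s) (w (s + 3)) (w (s + 6))"
    and s: "s \<in> {1..3}" and y: "y \<noteq> 0"
  shows "eta_den \<alpha> w y s > 0"
proof (rule ccontr)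
  have \<alpha>: "\<alpha> s > 0" "\<alpha> (s + 3) > 0" "\<alpha> (s + 6) > 0"
    using s by (auto intro!: pos[rule_format])
  assume "\<not> eta_den \<alpha> w y s > 0"
  moreover have "\<alpha> s * (w s \<bullet> y)\<^sup>2 \<ge> 0" "\<alpha> (s + 3) * (w (s + 3) \<bullet> y)\<^sup>2 \<ge> 0"
    "\<alpha> (s + 6) * (w (s + 6) \<bullet> y)\<^sup>2 \<ge> 0"
    using \<alpha> by simp_all
  ultimately have "\<alpha> s * (w s \<bullet> y)\<^sup>2 = 0" "\<alpha> (s + 3) * (w (s + 3) \<bullet> y)\<^sup>2 = 0"
    "\<alpha> (s + 6) * (w (s + 6) \<bullet> y)\<^sup>2 = 0"
    unfolding eta_den_def by linarith+
  then have 0: "w s \<bullet> y = 0" "w (s + 3) \<bullet> y = 0" "w (s + 6) \<bullet> y = 0"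
    using \<alpha> by simp_all
  \<comment> \<open>\<open>y\<close> is a combination of vectors that are all orthogonal to it,
    which forces \<open>y \<bullet> y = 0\<close>.\<close>
  obtain p q r where "y = p *\<^sub>R w s + q *\<^sub>R w (s + 3) + r *\<^sub>R w (s + 6)"
    using lin_indep3_expand indep s by metis
  then have "y \<bullet> y = (p *\<^sub>R w s + q *\<^sub>R w (s + 3) + r *\<^sub>R w (s + 6)) \<bullet> y"
    by simp
  also have "\<dots> = 0"
    using 0 by (simp add: inner_add_left)
  finally show False
    using y by simp
qed

text \<open>Squared numerators and denominators both gain the factor \<open>c\<^sup>2\<close>. This
  carries bounds from the unit sphere to every nonzero \<open>y\<close>.\<close>

lemma eta_scaleR:
  assumes "c \<noteq> 0"
  shows "eta \<alpha> w \<sigma> (c *\<^sub>R y) = eta \<alpha> w \<sigma> y"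
proof -
  have "eta_num \<sigma> w (c *\<^sub>R y) s = c * eta_num \<sigma> w y s" for s
    by (simp add: eta_num_def algebra_simps)
  moreover have "eta_den \<alpha> w (c *\<^sub>R y) s = c\<^sup>2 * eta_den \<alpha> w y s" for s
    by (simp add: eta_den_def algebra_simps)
  ultimately show ?thesis
    using assms by (simp add: eta_eq_sum power_mult_distrib)
qed

text \<open>No denominator vanishes on the unit sphere, so \<open>eta\<close> is continuous on a
  nonempty compact set.\<close>

lemma eta_has_maximum:
  assumes "\<And>s y. s \<in> {1..3} \<Longrightarrow> y \<noteq> 0 \<Longrightarrow> eta_den \<alpha> w y s > 0"
  shows "\<exists>m. is_maximum {eta \<alpha> w \<sigma> y | y. y \<bullet> y = 1} m"
proof -
  have sphere: "{y :: real^3. y \<bullet> y = 1} = sphere 0 1"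
    by (auto simp: norm_eq_1)
  have "continuous_on (sphere 0 1) (eta \<alpha> w \<sigma>)"
    unfolding eta_eq_sum[abs_def]
  proof (intro continuous_on_sum continuous_on_divide ballI)
    fix s :: nat and y :: "real^3"
    assume "s \<in> {1..3}" "y \<in> sphere 0 1"
    then show "eta_den \<alpha> w y s \<noteq> 0"
      using assms[of s y] by force
  qed (unfold eta_num_def eta_den_def, (intro continuous_intros)+)
  moreover have "sphere (0 :: real^3) 1 \<noteq> {}"
    by simp
  ultimately obtain y where "y \<in> sphere 0 1" "\<forall>z\<in>sphere 0 1. eta \<alpha> w \<sigma> z \<le> eta \<alpha> w \<sigma> y"
    using continuous_attains_sup[OF compact_sphere] by blast
  then show ?thesis
    unfolding is_maximum_def sphere[symmetric] by blast
qed

lemma eta_le_maximum: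
  assumes "is_maximum {eta \<alpha> w \<sigma> y | y. y \<bullet> y = 1} m" and "y \<noteq> 0"
  shows "eta \<alpha> w \<sigma> y \<le> m"
proof -
  have "(inverse (norm y) *\<^sub>R y) \<bullet> (inverse (norm y) *\<^sub>R y) = 1"
    using assms(2) by (simp add: dot_square_norm power2_eq_square)
  then have "eta \<alpha> w \<sigma> (inverse (norm y) *\<^sub>R y) \<le> m"
    using assms(1) unfolding is_maximum_def by blast
  then show ?thesis
    using assms(2) by (simp add: eta_scaleR)
qed

section \<open>Coordinates \<open>v s \<bullet> x\<close> for an invertible matrix of
  columns\<close>

lemma exists_coordinates:
  assumes "invertible (cols3 a b c)"
  shows "\<exists>x. a \<bullet> x = p \<and> b \<bullet> x = q \<and> c \<bullet> x = r"
proof -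
  obtain M where "transpose (cols3 a b c) ** M = mat 1"
    using transpose_invertible[OF assms] unfolding invertible_def by auto
  then have "transpose (cols3 a b c) *v (M *v vector [p, q, r]) = vector [p, q, r]"
    by (simp add: matrix_vector_mul_assoc)
  then show ?thesis
    unfolding transpose_cols3_mult_vec by (auto simp: vec_eq_iff forall_3)
qed

text \<open>A left inverse of the transpose recovers \<open>x\<close> from its three inner
  products.\<close>

lemma coordinates_eq_0:
  assumes "invertible (cols3 a b c)" and "a \<bullet> x = 0" "b \<bullet> x = 0" "c \<bullet> x = 0"
  shows "x = 0"
proof -
  obtain M where M: "M ** transpose (cols3 a b c) = mat 1"
    using transpose_invertible[OF assms(1)] unfolding invertible_def by auto
  have "transpose (cols3 a b c) *v x = 0"
    unfolding transpose_cols3_mult_vec using assms by (simp add: vec_eq_iff forall_3)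
  then have "M *v (transpose (cols3 a b c) *v x) = 0"
    by simp
  then show ?thesis
    by (simp add: matrix_vector_mul_assoc M del: transpose_matrix_vector)
qed

section \<open>The criterion for M-positive semidefiniteness and definiteness\<close>

theorem theorem4p3:
  fixes A :: tensor4
    and \<alpha> :: "nat \<Rightarrow> real"
    and U :: "nat \<Rightarrow> real^3^3"
    and v w :: "nat \<Rightarrow> real^3"
  assumes A: "A \<in> tensor_space"
    and decomp: "\<forall>y. tensor_apply2 A y = (\<Sum>s = 1..10. \<alpha> s *\<^sub>R outer_product (U s *v y) (U s *v y))"
    and alpha_pos: "\<forall>s\<in>{1..9}. \<alpha> s > 0"
    and alpha_neg: "\<alpha> 10 < 0"
    and rank_one: "\<forall>s\<in>{1..9}. U s = outer_product (v s) (w s)"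
    and v_rep: "\<forall>s\<in>{1..3}. v s = v (s + 3) \<and> v (s + 3) = v (s + 6)"
    and nonsing_V: "invertible (cols3 (v 1) (v 2) (v 3))"
    and nonsing_W: "invertible (cols3 (w 1) (w 2) (w 3))"
    and nonsing_W_tilde: "invertible (cols3 (w 4) (w 5) (w 6))"
    and nonsing_W_hat: "invertible (cols3 (w 7) (w 8) (w 9))"
    and indep: "\<forall>s\<in>{1..3}. lin_indep3 (w s) (w (s + 3)) (w (s + 6))"
  shows "(M_PSD A \<longleftrightarrow>
            (\<exists>\<sigma> :: nat \<Rightarrow> real. U10_decomposition (U 10) v w \<sigma> \<and>
               (\<exists>m. is_maximum {eta \<alpha> w \<sigma> y | y. y \<bullet> y = 1} m \<and> m \<le> 1 / (- \<alpha> 10))))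
       \<and> (\<forall>\<sigma> :: nat \<Rightarrow> real. U10_decomposition (U 10) v w \<sigma> \<and>
               (\<exists>m. is_maximum {eta \<alpha> w \<sigma> y | y. y \<bullet> y = 1} m \<and> m < 1 / (- \<alpha> 10))
            \<longrightarrow> M_PD A)"
proof -
  have v: "v (s + 3) = v s" "v (s + 6) = v s" if "s \<in> {1..3}" for s
    using v_rep that by auto
  have den_pos: "eta_den \<alpha> w y s > 0" if "s \<in> {1..3}" "y \<noteq> 0" for s y
    using eta_den_pos[OF alpha_pos indep that] .
  \<comment> \<open>The rank-one terms factor as
    \<open>(v s \<bullet> x)\<^sup>2 * (w s \<bullet> y)\<^sup>2\<close>, and the repetition of the
    \<open>v s\<close> collects them in threes.\<close>
  have split: "biquadratic A x y =
      (\<Sum>s = 1..3. (v s \<bullet> x)\<^sup>2 * eta_den \<alpha> w y s) + \<alpha> 10 * (x \<bullet> (U 10 *v y))\<^sup>2" for x y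
  proof -
    have Us: "\<alpha> s * (x \<bullet> (U s *v y))\<^sup>2 = \<alpha> s * (v s \<bullet> x)\<^sup>2 * (w s \<bullet> y)\<^sup>2" if "s \<in> {1..9}" for s
      using rank_one that
      by (simp add: outer_product_mult_vec power_mult_distrib inner_commute mult_ac)
    have "\<alpha> s * (x \<bullet> (U s *v y))\<^sup>2 + \<alpha> (s + 3) * (x \<bullet> (U (s + 3) *v y))\<^sup>2
        + \<alpha> (s + 6) * (x \<bullet> (U (s + 6) *v y))\<^sup>2 = (v s \<bullet> x)\<^sup>2 * eta_den \<alpha> w y s"
      if "s \<in> {1..3}" for s
    proof -
      have "s \<in> {1..9}" "s + 3 \<in> {1..9}" "s + 6 \<in> {1..9}"
        using that by auto
      then show ?thesis
        by (simp only: Us v[OF that] eta_den_def algebra_simps)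
    qed
    then show ?thesis
      unfolding biquadratic_decomp[OF decomp[rule_format]] sum_1_10 by simp
  qed
  have form: "biquadratic A x y =
      (\<Sum>s = 1..3. (v s \<bullet> x)\<^sup>2 * eta_den \<alpha> w y s)
      + \<alpha> 10 * (\<Sum>s = 1..3. (v s \<bullet> x) * eta_num \<sigma> w y s)\<^sup>2"
    if "U10_decomposition (U 10) v w \<sigma>" for \<sigma> x y
    using that unfolding split U10_decomposition_iff
    by (simp add: inner_sum_right inner_commute mult_ac)
  have lower: "biquadratic A x y \<ge>
      (\<Sum>s = 1..3. (v s \<bullet> x)\<^sup>2 * eta_den \<alpha> w y s) * (1 + \<alpha> 10 * eta \<alpha> w \<sigma> y)"
    if "U10_decomposition (U 10) v w \<sigma>" "y \<noteq> 0" for \<sigma> x y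
  proof -
    have "(\<Sum>s = 1..3. (v s \<bullet> x) * eta_num \<sigma> w y s)\<^sup>2
        \<le> (\<Sum>s = 1..3. (v s \<bullet> x)\<^sup>2 * eta_den \<alpha> w y s) * eta \<alpha> w \<sigma> y"
      unfolding eta_eq_sum using den_pos that(2) by (intro weighted_Cauchy_Schwarz)
    \<comment> \<open>Multiplying by the negative \<open>\<alpha> 10\<close> turns the upper bound
      on the square into a lower bound on the form.\<close>
    from mult_left_mono_neg[OF this less_imp_le[OF alpha_neg]] show ?thesis
      unfolding form[OF that(1)] by (simp add: algebra_simps)
  qed
  have sum_nonneg': "(\<Sum>s = 1..3. (v s \<bullet> x)\<^sup>2 * eta_den \<alpha> w y s) \<ge> 0" if "y \<noteq> 0" for x y
    using den_pos that by (intro sum_nonneg mult_nonneg_nonneg) (auto intro: less_imp_le)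
  have psd_imp: "eta \<alpha> w \<sigma> y \<le> 1 / (- \<alpha> 10)"
    if psd: "M_PSD A" and dec: "U10_decomposition (U 10) v w \<sigma>" and y: "y \<noteq> 0" for \<sigma> y
  proof -
    \<comment> \<open>Equality case of the weighted inequality: for \<open>t = N / D\<close> both
      \<open>t\<^sup>2 * D\<close> and \<open>t * N\<close> equal \<open>N\<^sup>2 / D\<close>, so
      both sums collapse to \<open>eta\<close>.\<close>
    let ?t = "\<lambda>s. eta_num \<sigma> w y s / eta_den \<alpha> w y s"
    let ?e = "eta \<alpha> w \<sigma> y"
    obtain x where x: "v 1 \<bullet> x = ?t 1" "v 2 \<bullet> x = ?t 2" "v 3 \<bullet> x = ?t 3"
      using exists_coordinates[OF nonsing_V] by blast
    have "v s \<bullet> x = ?t s" if "s \<in> {1..3}" for s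
    proof -
      have "s = 1 \<or> s = 2 \<or> s = 3"
        using that by auto
      then show ?thesis
        using x by auto
    qed
    then have "(\<Sum>s = 1..3. (v s \<bullet> x)\<^sup>2 * eta_den \<alpha> w y s) = ?e"
      "(\<Sum>s = 1..3. (v s \<bullet> x) * eta_num \<sigma> w y s) = ?e"
      unfolding eta_eq_sum using den_pos[OF _ y]
      by (auto intro!: sum.cong simp: power2_eq_square)
    then have "0 \<le> ?e + \<alpha> 10 * ?e\<^sup>2"
      using psd form[OF dec, of x y] unfolding M_PSD_def by metis
    then have "0 \<le> ?e * (1 + \<alpha> 10 * ?e)"
      by (simp add: power2_eq_square algebra_simps)
    \<comment> \<open>The factor \<open>?e\<close> cancels only if it is positive; otherwise the
      bound holds because \<open>1 / (- \<alpha> 10)\<close> is positive.\<close>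
    then have "?e \<le> 0 \<or> 0 \<le> 1 + \<alpha> 10 * ?e"
      by (auto simp: zero_le_mult_iff)
    then show ?thesis
    proof
      assume "?e \<le> 0"
      also have "0 \<le> 1 / (- \<alpha> 10)"
        using alpha_neg by simp
      finally show ?thesis .
    next
      assume "0 \<le> 1 + \<alpha> 10 * ?e"
      then show ?thesis
        using alpha_neg by (simp add: field_simps)
    qed
  qed
  show ?thesis
  proof (intro conjI iffI allI impI)
    assume psd: "M_PSD A"
    obtain \<sigma> where \<sigma>: "U10_decomposition (U 10) v w \<sigma>"
      using ex_U10_decomposition[OF nonsing_V indep] by blast
    obtain m where m: "is_maximum {eta \<alpha> w \<sigma> y | y. y \<bullet> y = 1} m"
      using eta_has_maximum[OF den_pos] by blast
    then obtain y where "m = eta \<alpha> w \<sigma> y" "y \<bullet> y = 1"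
      unfolding is_maximum_def by blast
    \<comment> \<open>The maximum is attained at a unit vector, which is nonzero, so the pointwise
      bound applies to it.\<close>
    then have "m \<le> 1 / (- \<alpha> 10)"
      using psd_imp[OF psd \<sigma>, of y] by fastforce
    with \<sigma> m show "\<exists>\<sigma>. U10_decomposition (U 10) v w \<sigma> \<and>
        (\<exists>m. is_maximum {eta \<alpha> w \<sigma> y | y. y \<bullet> y = 1} m \<and> m \<le> 1 / (- \<alpha> 10))"
      by blast
  next
    assume "\<exists>\<sigma>. U10_decomposition (U 10) v w \<sigma> \<and>
        (\<exists>m. is_maximum {eta \<alpha> w \<sigma> y | y. y \<bullet> y = 1} m \<and> m \<le> 1 / (- \<alpha> 10))"
    then obtain \<sigma> m where \<sigma>: "U10_decomposition (U 10) v w \<sigma>"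
      and m: "is_maximum {eta \<alpha> w \<sigma> y | y. y \<bullet> y = 1} m" "m \<le> 1 / (- \<alpha> 10)"
      by blast
    have "biquadratic A x y \<ge> 0" for x y
    \<comment> \<open>The maximum controls \<open>eta\<close> only at nonzero \<open>y\<close>; at 0
      the form itself vanishes.\<close>
    proof (cases "y = 0")
      case True
      then show ?thesis
        by (simp add: biquadratic_def)
    next
      case False
      then have "eta \<alpha> w \<sigma> y \<le> 1 / (- \<alpha> 10)"
        using eta_le_maximum[OF m(1)] m(2) by force
      then have "1 + \<alpha> 10 * eta \<alpha> w \<sigma> y \<ge> 0"
        using alpha_neg by (simp add: field_simps)
      then show ?thesis
        using lower[OF \<sigma> False, of x] sum_nonneg'[OF False, of x] mult_nonneg_nonneg order_trans
        by blast
    qed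
    then show "M_PSD A"
      by (simp add: M_PSD_def)
  next
    fix \<sigma>
    assume "U10_decomposition (U 10) v w \<sigma> \<and>
        (\<exists>m. is_maximum {eta \<alpha> w \<sigma> y | y. y \<bullet> y = 1} m \<and> m < 1 / (- \<alpha> 10))"
    then obtain m where \<sigma>: "U10_decomposition (U 10) v w \<sigma>"
      and m: "is_maximum {eta \<alpha> w \<sigma> y | y. y \<bullet> y = 1} m" "m < 1 / (- \<alpha> 10)"
      by blast
    have "biquadratic A x y > 0" if x: "x \<noteq> 0" and y: "y \<noteq> 0" for x y
    proof -
      have "eta \<alpha> w \<sigma> y < 1 / (- \<alpha> 10)"
        using eta_le_maximum[OF m(1) y] m(2) by force
      then have *: "1 + \<alpha> 10 * eta \<alpha> w \<sigma> y > 0"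
        using alpha_neg by (simp add: field_simps)
      \<comment> \<open>One nonzero coordinate of \<open>x\<close> makes the weighted sum strictly
        positive, so both factors of the lower bound are.\<close>
      have "\<exists>s\<in>{1..3}. v s \<bullet> x \<noteq> 0"
      proof (rule ccontr)
        assume "\<not> (\<exists>s\<in>{1..3}. v s \<bullet> x \<noteq> 0)"
        then have "v s \<bullet> x = 0" if "s \<in> {1..3}" for s
          using that by blast
        then show False
          using coordinates_eq_0[OF nonsing_V, of x] x by simp
      qed
      then obtain s where s: "s \<in> {1..3}" "v s \<bullet> x \<noteq> 0"
        by blast
      have "(\<Sum>s = 1..3. (v s \<bullet> x)\<^sup>2 * eta_den \<alpha> w y s) > 0"
        using s den_pos[OF _ y]
        by (intro sum_pos2[of _ s]) (auto intro!: mult_nonneg_nonneg intro: less_imp_le)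
      from mult_pos_pos[OF this *] lower[OF \<sigma> y, of x] show ?thesis
        by linarith
    qed
    then show "M_PD A"
      by (simp add: M_PD_def)
  qed
qed

end
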